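(* Let $1\le p'<p$ be integers and $0<\beta<1$. Let $X$ be a $p$-dimensional random vector with distribution $\mathcal N_p(0,\Sigma)$, where $\Sigma$ is a positive definite covariance matrix. Let $\mathbf a_1,\dots,\mathbf a_p$ be an orthonormal basis of eigenvectors of $\Sigma$ with corresponding eigenvalues $\lambda_1,\dots,\lambda_p$. For each set $I\subset\{1,\dots,p\}$ with $|I|=p'$, let $B_I$ be the fastPRIM box of probability $\beta$ on the projection of $X$ to the subspace spanned by $\{\mathbf a_j: j\in I\}$, and let $\mathcal B=\{B_I : |I|=p'\}$. Then $$\arg\min_{B\in\mathcal B}\mathrm{Vol}(B\mid\beta)=\mathbf B,$$ where $\mathbf B$ is the box in the subspace spanned by the $p'$ pettiest components; that is, $B_I$ has minimal volume in $\mathcal B$ if and only if $I$ is a set of $p'$ pettiest components (so the minimizer is unique whenever the choice of the $p'$ pettiest components is unique).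
   Context: Components: the eigenvectors $\mathbf a_j$ of $\Sigma$ are called components, and the variance of the component $\mathbf a_j$ is its eigenvalue $\lambda_j=\mathrm{Var}(\mathbf a_j^T X)$. A set $I\subset\{1,\dots,p\}$ with $|I|=p'$ is a set of $p'$ pettiest components if it indexes $p'$ components of smallest variance, i.e. $\lambda_i\le\lambda_j$ for all $i\in I$, $j\notin I$. fastPRIM box: put $Y_j=\mathbf a_j^T X$ (the coordinates of $X$ after rotation in the direction of the eigenvectors). For $I$ with $|I|=p'$, the fastPRIM box of probability $\beta$ on the projection to the span of $\{\mathbf a_j:j\in I\}$ is, in the coordinates $(y_j)_{j\in I}$ with respect to the basis $(\mathbf a_j)_{j\in I}$, the box centered at the mean with sides parallel to the rotated axes, $$B_I=\prod_{j\in I}\Big[q_j\big(\tfrac12(1-\beta^{1/p'})\big),\,q_j\big(\tfrac12(1+\beta^{1/p'})\big)\Big],$$ where $q_j(u)$ is the $u$-quantile of $Y_j$. Thus each side has marginal probability $\beta^{1/p'}$. $\mathrm{Vol}(B\mid\beta)$ denotes the $p'$-dimensional Lebesgue measure of the box $B\in\mathcal B$. The family $\mathcal B$ is regarded as indexed by the $\binom{p}{p'}$ sets $I$. *)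

theory Defs
  imports "HOL-Probability.Probability"
begin

definition positive_definite :: "real^'n^'n \<Rightarrow> bool" where
  "positive_definite S \<longleftrightarrow>
     transpose S = S \<and> (\<forall>x. x \<noteq> 0 \<longrightarrow> 0 < x \<bullet> (S *v x))"

definition multivariate_normal_density ::
    "real^'n \<Rightarrow> real^'n^'n \<Rightarrow> real^'n \<Rightarrow> real" where
  "multivariate_normal_density m S x =
     exp (- ((x - m) \<bullet> (matrix_inv S *v (x - m))) / 2)
       / sqrt ((2 * pi) ^ CARD('n) * det S)"

text \<open>Nondegenerate case only: the density formula needs \<open>S\<close> positive definite.\<close>
definition multivariate_normal ::
    "'w measure \<Rightarrow> ('w \<Rightarrow> real^'n) \<Rightarrow> real^'n \<Rightarrow> real^'n^'n \<Rightarrow> bool" where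
  "multivariate_normal M X m S \<longleftrightarrow>
     distributed M lborel X (\<lambda>x. ennreal (multivariate_normal_density m S x))"

definition orthonormal_eigenbasis ::
    "real^'n^'n \<Rightarrow> ('n \<Rightarrow> real^'n) \<Rightarrow> ('n \<Rightarrow> real) \<Rightarrow> bool" where
  "orthonormal_eigenbasis S a l \<longleftrightarrow>
     (\<forall>i j. a i \<bullet> a j = (if i = j then 1 else 0)) \<and>
     span (range a) = UNIV \<and>
     (\<forall>j. S *v a j = l j *\<^sub>R a j)"

definition pettiest :: "('n::finite \<Rightarrow> real) \<Rightarrow> nat \<Rightarrow> 'n set \<Rightarrow> bool" where
  "pettiest l p' I \<longleftrightarrow> card I = p' \<and> (\<forall>i\<in>I. \<forall>j. j \<notin> I \<longrightarrow> l i \<le> l j)"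

text \<open>Lower quantile of a distribution on the line; only meaningful for \<open>0 < u < 1\<close>.\<close>
definition quantile :: "real measure \<Rightarrow> real \<Rightarrow> real" where
  "quantile N u = Inf {y. u \<le> cdf N y}"

definition component_quantile ::
    "'w measure \<Rightarrow> ('w \<Rightarrow> real^'n) \<Rightarrow> real^'n \<Rightarrow> real \<Rightarrow> real" where
  "component_quantile M X v u = quantile (distr M borel (\<lambda>\<omega>. v \<bullet> X \<omega>)) u"

text \<open>A point of the span of \<open>{a j | j \<in> I}\<close> is given by its coordinates \<open>(y j)\<close>, \<open>j \<in> I\<close>,
  with respect to the vectors \<open>a j\<close>, that is, by an element of \<open>I \<rightarrow>\<^sub>E UNIV\<close>.\<close>
definition fastPRIM_box ::
    "'w measure \<Rightarrow> ('w \<Rightarrow> real^'n) \<Rightarrow> ('n \<Rightarrow> real^'n) \<Rightarrow> real \<Rightarrow> 'n set \<Rightarrow> ('n \<Rightarrow> real) set" where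
  "fastPRIM_box M X a b I =
     (\<Pi>\<^sub>E j\<in>I. {component_quantile M X (a j) ((1 - b powr (1 / real (card I))) / 2) ..
                component_quantile M X (a j) ((1 + b powr (1 / real (card I))) / 2)})"

definition box_volume :: "'n set \<Rightarrow> ('n \<Rightarrow> real) set \<Rightarrow> real" where
  "box_volume I B = measure (Pi\<^sub>M I (\<lambda>_. lborel)) B"

end

theory Submission
  imports Defs
begin

text \<open>In the coordinates of the eigenbasis the Gaussian density factors into the densities of
  \<open>N(0, l j)\<close>, so the quantiles of \<open>a j \<bullet> X\<close> are \<open>sqrt (l j)\<close> times the standard normal ones. Hence
  every box with \<open>card I = p'\<close> has volume \<open>d ^ p' * (\<Prod>j\<in>I. sqrt (l j))\<close> with the same \<open>d > 0\<close>, and a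
  product of positive weights over \<open>p'\<close> indices is minimal exactly for the \<open>p'\<close> smallest weights:
  an exchange of two indices gives one direction, a comparison of \<open>I - J\<close> with \<open>J - I\<close> the other.\<close>

section \<open>Orthogonal invariance of Lebesgue measure and integration in orthonormal
  coordinates\<close>

text \<open>The library has invariance of Lebesgue measure under linear isometries of \<open>real^'n\<close> only for
  well-ordered \<open>'n\<close>. Here the image measure \<open>N\<close> is translation invariant and agrees with Lebesgue
  measure on the centred unit ball \<open>B\<close>; evaluating \<open>\<integral>\<integral> 1\<^sub>A(x) 1\<^sub>B(y - x)\<close> in both orders
  yields \<open>N A * N B = lborel A * N B\<close>.\<close>
lemma lborel_distr_orthogonal_transformation:
  fixes h :: "'a::euclidean_space \<Rightarrow> 'a"
  assumes h: "orthogonal_transformation h"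
  shows "distr lborel borel h = lborel"
proof -
  have lin: "linear h" and bij: "bij h"
    using h by (simp_all add: orthogonal_transformation_linear orthogonal_transformation_bij)
  have [measurable]: "h \<in> borel_measurable borel"
    using lin by (intro borel_measurable_continuous_onI linear_continuous_on linear_conv_bounded_linear[THEN iffD1])
  define N where "N = distr lborel borel h"
  have [measurable_cong]: "sets N = sets borel" by (simp add: N_def)
  have nn: "(\<integral>\<^sup>+x. f x \<partial>N) = (\<integral>\<^sup>+x. f (h x) \<partial>lborel)" if "f \<in> borel_measurable borel" for f
    using that by (simp add: N_def nn_integral_distr)
  have transl: "(\<integral>\<^sup>+x. f (x + c) \<partial>lborel) = (\<integral>\<^sup>+x. f x \<partial>lborel)"
    if [measurable]: "f \<in> borel_measurable borel" for f :: "'a \<Rightarrow> ennreal" and c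
  proof -
    have "(\<integral>\<^sup>+x. f x \<partial>lborel) = (\<integral>\<^sup>+x. f x \<partial>distr lborel borel ((+) c))"
      by (simp add: lborel_distr_plus)
    then show ?thesis by (simp add: nn_integral_distr add.commute)
  qed
  have translN: "(\<integral>\<^sup>+x. f (x + c) \<partial>N) = (\<integral>\<^sup>+x. f x \<partial>N)"
    if [measurable]: "f \<in> borel_measurable borel" for f :: "'a \<Rightarrow> ennreal" and c
  proof -
    \<comment> \<open>Surjectivity of \<open>h\<close> turns a translation by \<open>c\<close> after
      \<open>h\<close> into a translation by \<open>d\<close> before it, where Lebesgue measure is
      invariant.\<close>
    obtain d where d: "c = h d" using bij by (meson bij_pointE)
    have "(\<integral>\<^sup>+x. f (x + c) \<partial>N) = (\<integral>\<^sup>+x. f (h (x + d)) \<partial>lborel)"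
      by (simp add: nn d linear_add[OF lin])
    also have "\<dots> = (\<integral>\<^sup>+x. f x \<partial>N)"
      by (subst transl[of "\<lambda>x. f (h x)"]) (simp_all add: nn)
    finally show ?thesis .
  qed
  let ?B = "ball (0::'a) 1"
  have [measurable]: "?B \<in> sets borel"
    by simp
  define G where "G = emeasure lborel ?B"
  have G: "G \<noteq> 0" "G \<noteq> \<infinity>"
    by (simp_all add: G_def emeasure_lborel_ball_finite emeasure_ball unit_ball_vol_pos less_imp_neq[symmetric])
  \<comment> \<open>\<open>h\<close> preserves norms, so the preimage of a centred ball is the ball
    itself.\<close>
  have ballN: "emeasure N ?B = G"
    by (simp add: N_def G_def emeasure_distr vimage_def orthogonal_transformation_norm[OF h] ball_def)
  \<comment> \<open>Centred balls have finite \<open>N\<close>-measure and exhaust the space; this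
    sigma-finiteness licenses the two exchanges of integrals below.\<close>
  have sf: "sigma_finite_measure N"
  proof
    have "emeasure N (ball 0 (real n)) \<noteq> \<infinity>" for n
      by (simp add: N_def emeasure_distr vimage_def orthogonal_transformation_norm[OF h] ball_def)
         (use emeasure_lborel_ball_finite[of "0::'a" "real n"] in \<open>simp add: ball_def\<close>)
    moreover have "(\<Union>n. ball (0::'a) (real n)) = UNIV"
      by (auto intro: reals_Archimedean2)
    ultimately show "\<exists>A. countable A \<and> A \<subseteq> sets N \<and> \<Union>A = space N \<and> (\<forall>a\<in>A. emeasure N a \<noteq> \<infinity>)"
      by (intro exI[of _ "range (\<lambda>n. ball 0 (real n))"]) (auto simp: N_def)
  qed
  interpret pair_sigma_finite lborel N
    using sf by (simp add: pair_sigma_finite_def lborel.sigma_finite_measure_axioms)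
  have "emeasure N A = emeasure lborel A" if A[measurable]: "A \<in> sets borel" for A
  proof -
    let ?f = "\<lambda>x y. indicator A x * indicator ?B (y - x) :: ennreal"
    have "emeasure N A * G = (\<integral>\<^sup>+x. indicator A x * G \<partial>N)"
      by (simp add: nn_integral_multc)
    also have "\<dots> = (\<integral>\<^sup>+x. (\<integral>\<^sup>+y. ?f x y \<partial>lborel) \<partial>N)"
    proof (rule nn_integral_cong)
      fix x
      have [measurable]: "(\<lambda>y. indicator ?B (y - x) :: ennreal) \<in> borel_measurable borel"
        by measurable
      have "(\<integral>\<^sup>+y. indicator ?B (y - x) \<partial>lborel) = G"
        using transl[of "\<lambda>y. indicator ?B (y - x)" x, symmetric] by (simp add: G_def)
      then show "indicator A x * G = (\<integral>\<^sup>+y. ?f x y \<partial>lborel)"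
        by (simp add: nn_integral_cmult)
    qed
    also have "\<dots> = (\<integral>\<^sup>+y. (\<integral>\<^sup>+x. ?f x y \<partial>N) \<partial>lborel)"
      by (rule Fubini') measurable
    also have "\<dots> = (\<integral>\<^sup>+y. (\<integral>\<^sup>+x. indicator A (x + y) * indicator ?B x \<partial>N) \<partial>lborel)"
    proof (rule nn_integral_cong)
      fix y
      \<comment> \<open>The shift turns \<open>y - x\<close> into \<open>- x\<close>, and the ball
        is symmetric under negation.\<close>
      have "(\<integral>\<^sup>+x. ?f x y \<partial>N) = (\<integral>\<^sup>+x. ?f (x + y) y \<partial>N)"
        by (rule translN[symmetric]) measurable
      then show "(\<integral>\<^sup>+x. ?f x y \<partial>N) = (\<integral>\<^sup>+x. indicator A (x + y) * indicator ?B x \<partial>N)"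
        by (simp add: indicator_def)
    qed
    also have "\<dots> = (\<integral>\<^sup>+x. (\<integral>\<^sup>+y. indicator A (x + y) * indicator ?B x \<partial>lborel) \<partial>N)"
      by (rule Fubini'[symmetric]) measurable
    also have "\<dots> = (\<integral>\<^sup>+x. emeasure lborel A * indicator ?B x \<partial>N)"
    proof (rule nn_integral_cong)
      fix x
      show "(\<integral>\<^sup>+y. indicator A (x + y) * indicator ?B x \<partial>lborel) = emeasure lborel A * indicator ?B x"
        using transl[of "indicator A" x] by (simp add: nn_integral_multc add.commute)
    qed
    also have "\<dots> = emeasure lborel A * G"
      by (subst nn_integral_cmult_indicator) (simp_all add: ballN)
    finally show ?thesis
      using G by (simp add: mult.commute[of _ G] ennreal_mult_cancel_left)
  qed
  then show ?thesis
    unfolding N_def[symmetric] by (intro measure_eqI) (auto simp: N_def)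
qed

interpretation lborel_product: product_sigma_finite "\<lambda>_::'i. lborel :: real measure"
  by standard

lemma measurable_vec_lambda_PiM:
  "vec_lambda \<in> Pi\<^sub>M UNIV (\<lambda>_::'n::finite. lborel :: real measure) \<rightarrow>\<^sub>M borel"
  by (subst borel_measurable_euclidean_space)
     (auto simp: Basis_vec_def inner_axis intro!: measurable_compose[OF measurable_component_singleton])

text \<open>Lebesgue measure is determined by its values on boxes, and a box pulls back to a product
  of intervals with the same side lengths.\<close>

lemma distr_PiM_vec_lambda:
  "distr (Pi\<^sub>M UNIV (\<lambda>_::'n::finite. lborel :: real measure)) borel vec_lambda = lborel"
proof (rule lborel_eqI[symmetric])
  note [measurable] = measurable_vec_lambda_PiM
  fix l u :: "real^'n" assume le: "\<And>b. b \<in> Basis \<Longrightarrow> l \<bullet> b \<le> u \<bullet> b"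
  then have le': "l $ i \<le> u $ i" for i
    by (metis axis_in_Basis_iff inner_axis inner_real_def insertI1 mult.right_neutral Basis_real_def)
  have "vec_lambda -` box l u = (\<Pi>\<^sub>E i\<in>UNIV. {l$i <..< u$i})"
    by (auto simp: mem_box_cart PiE_def Pi_iff)
  then have "emeasure (distr (Pi\<^sub>M UNIV (\<lambda>_::'n. lborel :: real measure)) borel vec_lambda) (box l u) = 
    (\<Prod>i\<in>UNIV. ennreal (u$i - l$i))"
    using le' by (simp add: emeasure_distr space_PiM lborel_product.emeasure_PiM)
  also have "\<dots> = ennreal (\<Prod>i\<in>UNIV. (u - l) $ i)"
    using le' by (simp add: prod_ennreal)
  also have "(\<Prod>i\<in>UNIV. (u - l) $ i) = (\<Prod>b\<in>Basis. (u - l) \<bullet> b)"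
    by (rule prod.reindex_bij_witness[of _ "\<lambda>b. THE i. b = axis i 1" "\<lambda>i. axis i 1"])
       (auto simp: Basis_vec_def inner_axis axis_eq_axis)
  finally show "emeasure (distr (Pi\<^sub>M UNIV (\<lambda>_::'n. lborel :: real measure)) borel vec_lambda) (box l u) = 
     (\<Prod>b\<in>Basis. (u - l) \<bullet> b)" .
qed simp

text \<open>Replacing the standard basis by \<open>a\<close> is an orthogonal transformation, so no
  Jacobian factor appears.\<close>

lemma nn_integral_lborel_orthonormal_coordinates:
  fixes a :: "'n::finite \<Rightarrow> real^'n"
  assumes a: "\<And>i j. a i \<bullet> a j = (if i = j then 1 else 0)"
    and f[measurable]: "f \<in> borel_measurable borel"
  shows "(\<integral>\<^sup>+x. f x \<partial>lborel) = (\<integral>\<^sup>+y. f (\<Sum>i\<in>UNIV. y i *\<^sub>R a i) \<partial>Pi\<^sub>M UNIV (\<lambda>_. lborel))"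
proof -
  note [measurable] = measurable_vec_lambda_PiM
  let ?h = "\<lambda>x::real^'n. \<Sum>i\<in>UNIV. (x $ i) *\<^sub>R a i"
  have h: "orthogonal_transformation ?h"
    unfolding orthogonal_transformation_def
  proof (intro conjI allI)
    show "linear ?h"
      by (auto intro!: linearI simp: scaleR_add_left sum.distrib scaleR_sum_right)
    show "?h v \<bullet> ?h w = v \<bullet> w" for v w
      by (simp add: inner_sum_left inner_sum_right a if_distrib cong: if_cong) (simp add: inner_vec_def mult.commute)
  qed
  have [measurable]: "?h \<in> borel_measurable borel"
    by measurable
  have "(\<integral>\<^sup>+x. f x \<partial>lborel) = (\<integral>\<^sup>+x. f x \<partial>distr (distr (Pi\<^sub>M UNIV (\<lambda>_::'n. lborel)) borel vec_lambda) borel ?h)"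
    by (simp add: lborel_distr_orthogonal_transformation[OF h] distr_PiM_vec_lambda)
  then show ?thesis
    by (simp add: nn_integral_distr)
qed


section \<open>Gaussian density in the eigenbasis and laws of the components\<close>

lemma inner_eigenbasis_coordinate:
  fixes a :: "'n::finite \<Rightarrow> real^'n"
  assumes "orthonormal_eigenbasis S a l"
  shows "(\<Sum>i\<in>UNIV. y i *\<^sub>R a i) \<bullet> a j = y j"
proof -
  have "y i * (a i \<bullet> a j) = (if i = j then y i else 0)" for i
    using assms by (simp add: orthonormal_eigenbasis_def)
  then show ?thesis
    by (simp add: inner_sum_left)
qed

text \<open>The quadratic form of \<open>S\<close> takes the value \<open>l j\<close> at the unit
  vector \<open>a j\<close>.\<close>

lemma positive_definite_eigenvalue_pos:
  assumes "positive_definite S" "orthonormal_eigenbasis S a l"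
  shows "0 < l j"
proof -
  have 1: "a j \<bullet> a j = 1" and 2: "S *v a j = l j *\<^sub>R a j"
    using assms(2) by (auto simp: orthonormal_eigenbasis_def)
  then have "a j \<noteq> 0" by auto
  then have "0 < a j \<bullet> (S *v a j)" using assms(1) by (auto simp: positive_definite_def)
  then show ?thesis by (simp add: 1 2)
qed

text \<open>A trivial kernel yields a left inverse, which for a square matrix is two-sided; hence
  the choice operator in \<open>matrix_inv\<close> picks a genuine inverse.\<close>

lemma positive_definite_matrix_inv:
  fixes S :: "real^'n^'n"
  assumes "positive_definite S"
  shows "matrix_inv S ** S = mat 1"
proof -
  have "\<forall>x. S *v x = 0 \<longrightarrow> x = 0"
    using assms by (metis inner_zero_right less_irrefl positive_definite_def)
  then obtain B where "B ** S = mat 1"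
    using matrix_left_invertible_ker[of S] by blast
  then have "S ** B = mat 1 \<and> B ** S = mat 1"
    by (simp add: matrix_left_right_inverse)
  then show ?thesis
    unfolding matrix_inv_def by (rule someI2) blast
qed

text \<open>The inverse acts on \<open>a i\<close> as multiplication by \<open>1 / l i\<close>, and
  orthonormality removes the cross terms.\<close>

lemma matrix_inv_quadratic_form_eigenbasis:
  fixes S :: "real^'n^'n"
  assumes S: "positive_definite S" and a: "orthonormal_eigenbasis S a l"
  shows "(\<Sum>i\<in>UNIV. y i *\<^sub>R a i) \<bullet> (matrix_inv S *v (\<Sum>i\<in>UNIV. y i *\<^sub>R a i)) = (\<Sum>i\<in>UNIV. (y i)\<^sup>2 / l i)"
proof -
  have inv: "matrix_inv S *v a i = (1 / l i) *\<^sub>R a i" for i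
  proof -
    have "a i = (matrix_inv S ** S) *v a i"
      by (simp add: positive_definite_matrix_inv[OF S])
    also have "\<dots> = matrix_inv S *v (l i *\<^sub>R a i)"
      using a by (simp add: orthonormal_eigenbasis_def flip: matrix_vector_mul_assoc)
    also have "\<dots> = l i *\<^sub>R (matrix_inv S *v a i)"
      by (simp add: matrix_vector_mult_scaleR)
    finally have "(1 / l i) *\<^sub>R a i = (1 / l i) *\<^sub>R (l i *\<^sub>R (matrix_inv S *v a i))" by simp
    then show ?thesis
      using positive_definite_eigenvalue_pos[OF S a, of i] by simp
  qed
  have "matrix_inv S *v (\<Sum>i\<in>UNIV. y i *\<^sub>R a i) = (\<Sum>i\<in>UNIV. matrix_inv S *v (y i *\<^sub>R a i))"
    by (simp add: linear_sum[OF matrix_vector_mul_linear])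
  also have "\<dots> = (\<Sum>i\<in>UNIV. (y i / l i) *\<^sub>R a i)"
    by (simp add: matrix_vector_mult_scaleR inv)
  finally show ?thesis
    by (simp add: inner_sum_right inner_eigenbasis_coordinate[OF a] power2_eq_square mult.commute)
qed

text \<open>Once the quadratic form is diagonal, the exponential splits over the coordinates. The
  leading quotient collects the normalising factors of both sides and is left unevaluated.\<close>

lemma multivariate_normal_density_eigenbasis:
  fixes S :: "real^'n^'n"
  assumes S: "positive_definite S" and a: "orthonormal_eigenbasis S a l"
  shows "multivariate_normal_density 0 S (\<Sum>i\<in>UNIV. y i *\<^sub>R a i) =
    (\<Prod>i\<in>UNIV. sqrt (2 * pi * l i)) / sqrt ((2 * pi) ^ CARD('n) * det S) *
    (\<Prod>i\<in>UNIV. normal_density 0 (sqrt (l i)) (y i))"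
proof -
  have l: "0 < l i" for i
    by (rule positive_definite_eigenvalue_pos[OF S a])
  have "(\<Prod>i\<in>UNIV. sqrt (2 * pi * l i)) * (\<Prod>i\<in>UNIV. normal_density 0 (sqrt (l i)) (y i)) =
      (\<Prod>i\<in>UNIV. exp (- ((y i)\<^sup>2 / l i) / 2))"
    unfolding prod.distrib[symmetric]
  proof (rule prod.cong)
    fix i
    have "sqrt (2 * pi * l i) \<noteq> 0" using l[of i] by simp
    then show "sqrt (2 * pi * l i) * normal_density 0 (sqrt (l i)) (y i) = exp (- ((y i)\<^sup>2 / l i) / 2)"
      using l[of i] by (simp add: normal_density_def mult.commute[of 2])
  qed simp
  also have "\<dots> = exp (- (\<Sum>i\<in>UNIV. (y i)\<^sup>2 / l i) / 2)"
    by (simp add: sum_negf sum_divide_distrib flip: exp_sum)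
  finally show ?thesis
    by (simp add: multivariate_normal_density_def matrix_inv_quadratic_form_eigenbasis[OF S a])
qed

text \<open>In eigenbasis coordinates the integral over a cylinder set factors; every coordinate
  other than \<open>j\<close> integrates to 1, which leaves the law of coordinate \<open>j\<close>
  up to the constant \<open>c\<close>.\<close>

lemma multivariate_normal_component:
  fixes S :: "real^'n^'n"
  assumes M: "prob_space M" and S: "positive_definite S"
    and X: "multivariate_normal M X 0 S" and a: "orthonormal_eigenbasis S a l"
  shows "distributed M lborel (\<lambda>\<omega>. a j \<bullet> X \<omega>) (\<lambda>x. ennreal (normal_density 0 (sqrt (l j)) x))"
proof -
  interpret prob_space M by (rule M)
  let ?d = "multivariate_normal_density 0 S"
  let ?nd = "\<lambda>i. normal_density 0 (sqrt (l i))"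
  define c where "c = (\<Prod>i\<in>UNIV. sqrt (2 * pi * l i)) / sqrt ((2 * pi) ^ CARD('n) * det S)"
  have dX: "distributed M lborel X (\<lambda>x. ennreal (?d x))"
    using X by (simp add: multivariate_normal_def)
  have [measurable]: "X \<in> M \<rightarrow>\<^sub>M borel" "(\<lambda>x. ennreal (?d x)) \<in> borel_measurable borel"
    using dX by (auto simp: distributed_def)
  have l: "0 < l i" for i
    by (rule positive_definite_eigenvalue_pos[OF S a])
  have law: "(\<integral>\<^sup>+\<omega>. indicator A (a j \<bullet> X \<omega>) \<partial>M) = ennreal c * emeasure (density lborel (?nd j)) A"
    if [measurable]: "A \<in> sets borel" for A
  proof -
    \<comment> \<open>Absorbing the indicator into the factor at \<open>j\<close> makes the
      integrand a single product over all coordinates.\<close>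
    let ?f = "\<lambda>i t. ennreal (?nd i t) * (if i = j then indicator A t else 1)"
    have "(\<integral>\<^sup>+\<omega>. indicator A (a j \<bullet> X \<omega>) \<partial>M) = (\<integral>\<^sup>+x. ennreal (?d x) * indicator A (a j \<bullet> x) \<partial>lborel)"
      by (rule distributed_nn_integral[OF dX, symmetric]) measurable
    also have "\<dots> = (\<integral>\<^sup>+y. ennreal (?d (\<Sum>i\<in>UNIV. y i *\<^sub>R a i)) * indicator A (y j) \<partial>Pi\<^sub>M UNIV (\<lambda>_. lborel))"
      using a by (subst nn_integral_lborel_orthonormal_coordinates[of a])
        (simp_all add: orthonormal_eigenbasis_def inner_commute[of "a j"] inner_eigenbasis_coordinate[OF a])
    also have "\<dots> = (\<integral>\<^sup>+y. ennreal c * (\<Prod>i\<in>UNIV. ?f i (y i)) \<partial>Pi\<^sub>M UNIV (\<lambda>_. lborel))"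
      unfolding multivariate_normal_density_eigenbasis[OF S a, folded c_def]
      by (intro nn_integral_cong)
         (simp add: prod.distrib prod_nonneg ennreal_mult'' prod_ennreal mult.assoc)
    also have "\<dots> = ennreal c * (\<integral>\<^sup>+y. (\<Prod>i\<in>UNIV. ?f i (y i)) \<partial>Pi\<^sub>M UNIV (\<lambda>_. lborel))"
      by (rule nn_integral_cmult) measurable
    also have "(\<integral>\<^sup>+y. (\<Prod>i\<in>UNIV. ?f i (y i)) \<partial>Pi\<^sub>M UNIV (\<lambda>_. lborel)) = (\<Prod>i\<in>UNIV. integral\<^sup>N lborel (?f i))"
      by (rule lborel_product.product_nn_integral_prod) simp_all
    also have "\<dots> = (\<Prod>i\<in>UNIV. if i = j then emeasure (density lborel (?nd j)) A else 1)"
    proof (rule prod.cong)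
      fix i
      have "emeasure (density lborel (?nd i)) (space (density lborel (?nd i))) = 1"
        using l[of i] by (intro prob_space.emeasure_space_1 prob_space_normal_density) simp
      then show "integral\<^sup>N lborel (?f i) = (if i = j then emeasure (density lborel (?nd j)) A else 1)"
        by (simp add: emeasure_density)
    qed simp
    finally show ?thesis by simp
  qed
  \<comment> \<open>The total mass determines the constant, so \<open>det S\<close> need not be computed.\<close>
  have "ennreal c = 1"
  proof -
    have "emeasure (density lborel (?nd j)) (space (density lborel (?nd j))) = 1"
      using l[of j] by (intro prob_space.emeasure_space_1 prob_space_normal_density) simp
    then show ?thesis
      using law[of UNIV] by (simp add: emeasure_space_1)
  qed
  then have law': "emeasure (density lborel (?nd j)) A = (\<integral>\<^sup>+\<omega>. indicator A (a j \<bullet> X \<omega>) \<partial>M)"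
    if "A \<in> sets borel" for A
    using law[OF that] by simp
  have "distr M lborel (\<lambda>\<omega>. a j \<bullet> X \<omega>) = density lborel (?nd j)"
  proof (rule measure_eqI)
    fix A assume "A \<in> sets (distr M lborel (\<lambda>\<omega>. a j \<bullet> X \<omega>))"
    then have [measurable]: "A \<in> sets borel" by simp
    have "emeasure (distr M lborel (\<lambda>\<omega>. a j \<bullet> X \<omega>)) A = (\<integral>\<^sup>+x. indicator A x \<partial>distr M lborel (\<lambda>\<omega>. a j \<bullet> X \<omega>))"
      by simp
    also have "\<dots> = emeasure (density lborel (?nd j)) A"
      by (subst nn_integral_distr) (simp_all add: law')
    finally show "emeasure (distr M lborel (\<lambda>\<omega>. a j \<bullet> X \<omega>)) A = emeasure (density lborel (?nd j)) A" .
  qed simp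
  then show ?thesis
    by (simp add: distributed_def)
qed


section \<open>Quantiles of atomless distributions and of centred normal laws\<close>

context real_distribution
begin

text \<open>The limit 1 of the cdf at infinity exceeds \<open>u\<close>. With the lower bound below,
  this makes the \<open>Inf\<close> in \<open>quantile\<close> a true infimum.\<close>

lemma superlevel_cdf_nonempty:
  assumes "u < 1"
  shows "{y. u \<le> cdf M y} \<noteq> {}"
proof -
  have "eventually (\<lambda>y. u < cdf M y) at_top"
    using cdf_lim_at_top_prob assms by (rule order_tendstoD)
  then show ?thesis
    using eventually_happens'[OF trivial_limit_at_top_linorder, of "\<lambda>y. u < cdf M y"] by (auto intro: less_imp_le)
qed

lemma superlevel_cdf_bdd_below:
  assumes "0 < u"
  shows "bdd_below {y. u \<le> cdf M y}"
proof -
  have "eventually (\<lambda>y. cdf M y < u) at_bot"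
    using cdf_lim_at_bot assms by (rule order_tendstoD)
  then obtain c where "cdf M c < u"
    using eventually_happens'[OF trivial_limit_at_bot_linorder, of "\<lambda>y. cdf M y < u"] by auto
  then have "c \<le> y" if "u \<le> cdf M y" for y
    using that cdf_nondecreasing[of y c] by linarith
  then show ?thesis by (intro bdd_belowI[of _ c]) simp
qed

text \<open>Without atoms the cdf is continuous, and its limits are 0 and 1, so the intermediate
  value theorem applies.\<close>

lemma cdf_attains:
  assumes atomless: "\<And>x. measure M {x} = 0" and u: "0 < u" "u < 1"
  obtains y where "cdf M y = u"
proof -
  have "eventually (\<lambda>y. u < cdf M y) at_top" "eventually (\<lambda>y. cdf M y < u) at_bot"
    using order_tendstoD(1)[OF cdf_lim_at_top_prob u(2)] order_tendstoD(2)[OF cdf_lim_at_bot u(1)]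
    by auto
  then obtain c d where c: "cdf M c < u" and d: "u < cdf M d"
    using eventually_happens'[OF trivial_limit_at_bot_linorder] eventually_happens'[OF trivial_limit_at_top_linorder] by meson
  have "c \<le> d"
    using c d cdf_nondecreasing[of d c] by linarith
  then have "\<exists>y\<ge>c. y \<le> d \<and> cdf M y = u"
    using c d atomless by (intro IVT) (auto simp: isCont_cdf)
  then show ?thesis using that by blast
qed

lemma quantile_strict_mono:
  assumes atomless: "\<And>x. measure M {x} = 0" and "0 < u" "u < v" "v < 1"
  shows "quantile M u < quantile M v"
proof -
  obtain s where s: "cdf M s = u"
    by (rule cdf_attains[OF atomless, of u]) (use assms in auto)
  \<comment> \<open>A level strictly below \<open>v\<close> makes \<open>t\<close> a lower bound of
    the superlevel set of \<open>v\<close>; a point at level \<open>v\<close> itself could lie to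
    the right of the quantile if the cdf is flat there.\<close>
  obtain t where t: "cdf M t = (u + v) / 2"
    by (rule cdf_attains[OF atomless, of "(u + v) / 2"]) (use assms in auto)
  have "quantile M u \<le> s"
    unfolding quantile_def using s superlevel_cdf_bdd_below[OF \<open>0 < u\<close>] by (intro cInf_lower) auto
  also have "s < t"
    using s t \<open>u < v\<close> cdf_nondecreasing[of t s] by (auto simp: not_le[symmetric])
  also have "t \<le> quantile M v"
    unfolding quantile_def
  proof (rule cInf_greatest[OF superlevel_cdf_nonempty[OF \<open>v < 1\<close>]])
    fix y assume "y \<in> {y. v \<le> cdf M y}"
    then show "t \<le> y"
      using t \<open>u < v\<close> cdf_nondecreasing[of y t] by force
  qed
  finally show ?thesis .
qed

end

lemma std_normal_quantile_strict_mono: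
  assumes "0 < u" "u < v" "v < 1"
  shows "quantile std_normal_distribution u < quantile std_normal_distribution v"
proof (rule real_distribution.quantile_strict_mono[OF real_dist_normal_dist _ assms])
  show "measure std_normal_distribution {x} = 0" for x
  proof -
    have "AE y in lborel. y \<in> {x} \<longrightarrow> ennreal (std_normal_density y) = 0"
      using AE_lborel_singleton[of x] by eventually_elim simp
    then have "{x} \<in> null_sets std_normal_distribution"
      by (subst null_sets_density_iff) auto
    then show ?thesis by (simp add: measure_def null_setsD1)
  qed
qed

text \<open>Standardising \<open>Y\<close> by \<open>s\<close> shows that the superlevel sets of its
  cdf are those of the standard normal cdf stretched by \<open>s\<close>.\<close>

lemma (in prob_space) quantile_centered_normal:
  assumes Y: "distributed M lborel Y (\<lambda>x. ennreal (normal_density 0 s x))"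
    and s: "0 < s" and u: "0 < u" "u < 1"
  shows "quantile (distr M borel Y) u = s * quantile std_normal_distribution u"
proof -
  interpret N: real_distribution std_normal_distribution by (rule real_dist_normal_dist)
  have [measurable]: "Y \<in> M \<rightarrow>\<^sub>M borel"
    using Y by (auto simp: distributed_def)
  have "distributed M lborel (\<lambda>x. (Y x - 0) / s) (\<lambda>x. ennreal (std_normal_density x))"
    using normal_standard_normal_convert[OF s, of Y 0] Y by blast
  then have std: "distr M lborel (\<lambda>x. Y x / s) = std_normal_distribution"
    by (simp add: distributed_def)
  have cdf: "cdf (distr M borel Y) y = cdf std_normal_distribution (y / s)" for y
    unfolding std[symmetric] cdf_def
    using s by (simp add: measure_distr vimage_def divide_le_cancel)
  let ?A = "{z. u \<le> cdf std_normal_distribution z}"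
  have "{y. u \<le> cdf (distr M borel Y) y} = (*) s ` ?A"
    using s by (auto simp: cdf image_iff intro!: exI[of _ "_ / s"])
  \<comment> \<open>A continuous monotone map commutes with the infimum of a nonempty set that is
    bounded below.\<close>
  moreover have "s * Inf ?A = (INF z\<in>?A. s * z)"
    using s N.superlevel_cdf_nonempty[OF u(2)] N.superlevel_cdf_bdd_below[OF u(1)]
    by (intro continuous_at_Inf_mono) (auto simp: mono_def intro!: continuous_intros)
  ultimately show ?thesis
    by (simp add: quantile_def)
qed

section \<open>Volume of a fastPRIM box\<close>

text \<open>Side \<open>j\<close> is \<open>sqrt (l j)\<close> times a standard normal interquantile
  distance \<open>d\<close>. The levels depend on \<open>I\<close> only through its cardinality, so
  one \<open>d\<close> serves all boxes.\<close>

lemma fastPRIM_box_volume: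
  fixes S :: "real^'n^'n"
  assumes M: "prob_space M" and S: "positive_definite S"
    and X: "multivariate_normal M X 0 S" and a: "orthonormal_eigenbasis S a l"
    and b: "0 < b" "b < 1" and p: "1 \<le> p"
  obtains d where "0 < d"
    and "\<And>I. card I = p \<Longrightarrow> box_volume I (fastPRIM_box M X a b I) = d ^ p * (\<Prod>j\<in>I. sqrt (l j))"
proof -
  interpret prob_space M by (rule M)
  \<comment> \<open>\<open>c\<close> is the marginal probability of each side;
    \<open>0 < c < 1\<close> places both quantile levels strictly inside the unit interval.\<close>
  define c where "c = b powr (1 / real p)"
  have c: "0 < c" "c < 1"
    using b p powr_less_mono2[of "1 / real p" b 1] by (simp_all add: c_def)
  let ?q = "quantile std_normal_distribution"
  define d where "d = ?q ((1 + c) / 2) - ?q ((1 - c) / 2)"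
  have d: "0 < d"
    using std_normal_quantile_strict_mono[of "(1 - c) / 2" "(1 + c) / 2"] c by (simp add: d_def)
  have l: "0 < l j" for j
    by (rule positive_definite_eigenvalue_pos[OF S a])
  have q: "component_quantile M X (a j) u = sqrt (l j) * ?q u" if "0 < u" "u < 1" for u j
    unfolding component_quantile_def
    using multivariate_normal_component[OF M S X a] l that by (intro quantile_centered_normal) auto
  have "box_volume I (fastPRIM_box M X a b I) = d ^ p * (\<Prod>j\<in>I. sqrt (l j))" if I: "card I = p" for I
  proof -
    let ?J = "\<lambda>j. {sqrt (l j) * ?q ((1 - c) / 2) .. sqrt (l j) * ?q ((1 + c) / 2)}"
    have len: "emeasure lborel (?J j) = ennreal (sqrt (l j) * d)" for j
      using d l[of j] by (subst emeasure_lborel_Icc) (auto simp: d_def algebra_simps)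
    have box: "fastPRIM_box M X a b I = (\<Pi>\<^sub>E j\<in>I. ?J j)"
      using c by (simp add: fastPRIM_box_def I q flip: c_def)
    have "emeasure (Pi\<^sub>M I (\<lambda>_. lborel)) (fastPRIM_box M X a b I) = (\<Prod>j\<in>I. ennreal (sqrt (l j) * d))"
      unfolding box by (subst lborel_product.emeasure_PiM) (simp_all add: len)
    also have "\<dots> = ennreal (\<Prod>j\<in>I. sqrt (l j) * d)"
      using d l by (intro prod_ennreal) (simp add: less_imp_le)
    finally have "box_volume I (fastPRIM_box M X a b I) = (\<Prod>j\<in>I. sqrt (l j) * d)"
      using d l by (simp add: box_volume_def measure_def prod_nonneg less_imp_le)
    then show ?thesis
      by (simp add: prod.distrib I mult.commute)
  qed
  with d show ?thesis by (rule that)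
qed

section \<open>Products of positive weights over index sets of fixed size\<close>

text \<open>The factor over \<open>I \<inter> J\<close> is common. The equally large remainders
  \<open>I - J\<close> and \<open>J - I\<close> are separated by a threshold \<open>t\<close>, so
  their products lie on either side of the same power of \<open>t\<close>.\<close>

lemma prod_le_prod_if_pettiest:
  fixes w :: "'n::finite \<Rightarrow> real"
  assumes w: "\<And>i. 0 < w i" and I: "pettiest w p I" and J: "card J = p"
  shows "prod w I \<le> prod w J"
proof (cases "I - J = {}")
  case True
  then have "I = J"
    using I J by (intro card_subset_eq) (auto simp: pettiest_def)
  then show ?thesis by simp
next
  case False
  \<comment> \<open>The maximum is attained at an index of \<open>I\<close>, so \<open>t\<close> is
    at most every weight outside \<open>I\<close>.\<close>
  define t where "t = Max (w ` (I - J))"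
  have card: "card (I - J) = card (J - I)"
    using I J by (simp add: card_Diff_subset_Int pettiest_def Int_commute)
  have "t \<in> w ` (I - J)"
    unfolding t_def using False by (intro Max_in) auto
  then have t: "t \<le> w j" if "j \<in> J - I" for j
    using I that by (auto simp: pettiest_def)
  have "0 < t" using \<open>t \<in> w ` (I - J)\<close> w by auto
  have "prod w (I - J) \<le> (\<Prod>i\<in>I - J. t)"
    by (intro prod_mono) (auto simp: t_def w less_imp_le)
  also have "\<dots> = (\<Prod>j\<in>J - I. t)"
    by (simp add: card)
  also have "\<dots> \<le> prod w (J - I)"
    using t \<open>0 < t\<close> by (intro prod_mono) auto
  finally have le: "prod w (I - J) \<le> prod w (J - I)" .
  have "prod w I = prod w (I \<inter> J) * prod w (I - J)"
    by (subst prod.union_disjoint[symmetric]) (auto intro!: prod.cong)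
  also have "\<dots> \<le> prod w (I \<inter> J) * prod w (J - I)"
    using le w by (intro mult_left_mono prod_nonneg) (auto simp: less_imp_le)
  also have "\<dots> = prod w J"
    by (subst prod.union_disjoint[symmetric]) (auto intro!: prod.cong)
  finally show ?thesis .
qed

text \<open>Exchanging \<open>i\<close> in \<open>I\<close> for \<open>j\<close> outside keeps the
  cardinality; the untouched product is positive and cancels from the comparison.\<close>

lemma pettiest_if_prod_minimal:
  fixes w :: "'n::finite \<Rightarrow> real"
  assumes w: "\<And>i. 0 < w i" and I: "card I = p"
    and min: "\<And>J. card J = p \<Longrightarrow> prod w I \<le> prod w J"
  shows "pettiest w p I"
proof -
  have "w i \<le> w j" if i: "i \<in> I" and j: "j \<notin> I" for i j
  proof -
    have "card (insert j (I - {i})) = p"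
      using i j I card_Suc_Diff1[of I i] by simp
    then have "prod w I \<le> prod w (insert j (I - {i}))" by (rule min)
    moreover have "prod w I = w i * prod w (I - {i})"
      using i by (intro prod.remove) auto
    moreover have "0 < prod w (I - {i})"
      using w by (simp add: prod_pos)
    ultimately show ?thesis using j by simp
  qed
  then show ?thesis using I by (simp add: pettiest_def)
qed

section \<open>Volume minimisers among the boxes\<close>

theorem theorem3:
  fixes M :: "'w measure"
    and X :: "'w \<Rightarrow> real^'n"
    and S :: "real^'n^'n"
    and a :: "'n \<Rightarrow> real^'n"
    and l :: "'n \<Rightarrow> real"
    and p' :: nat
    and b :: real
  assumes "prob_space M"
    and "1 \<le> p'" and "p' < CARD('n)"
    and "0 < b" and "b < 1"
    and "positive_definite S"
    and "multivariate_normal M X 0 S"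
    and "orthonormal_eigenbasis S a l"
  shows "(\<forall>I. is_arg_min (\<lambda>J. box_volume J (fastPRIM_box M X a b J)) (\<lambda>J. card J = p') I
              \<longleftrightarrow> pettiest l p' I) \<and>
         ((\<exists>!I. pettiest l p' I) \<longrightarrow>
          (\<exists>!I. is_arg_min (\<lambda>J. box_volume J (fastPRIM_box M X a b J)) (\<lambda>J. card J = p') I))"
proof -
  let ?vol = "\<lambda>J. box_volume J (fastPRIM_box M X a b J)"
  let ?w = "\<lambda>j. sqrt (l j)"
  obtain d where d: "0 < d" and vol: "\<And>J. card J = p' \<Longrightarrow> ?vol J = d ^ p' * prod ?w J"
    using fastPRIM_box_volume[OF assms(1,6,7,8,4,5,2)] by blast
  have w: "0 < ?w j" for j
    using positive_definite_eigenvalue_pos[OF assms(6,8)] by simp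
  \<comment> \<open>The factor \<open>d ^ p'\<close> is positive and shared by all competitors, so
    it cancels.\<close>
  have le: "?vol I \<le> ?vol J \<longleftrightarrow> prod ?w I \<le> prod ?w J" if "card I = p'" "card J = p'" for I J
    using d that by (simp add: vol)
  have "is_arg_min ?vol (\<lambda>J. card J = p') I \<longleftrightarrow> pettiest l p' I" for I
  proof -
    have "is_arg_min ?vol (\<lambda>J. card J = p') I \<longleftrightarrow>
        card I = p' \<and> (\<forall>J. card J = p' \<longrightarrow> prod ?w I \<le> prod ?w J)"
      using le by (auto simp: is_arg_min_linorder)
    also have "\<dots> \<longleftrightarrow> pettiest ?w p' I"
      using prod_le_prod_if_pettiest[of ?w p' I] pettiest_if_prod_minimal[of ?w I p'] w
      by (auto simp: pettiest_def[of _ _ I])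
    \<comment> \<open>The square root is strictly increasing, so it preserves and reflects the order
      of the eigenvalues.\<close>
    also have "\<dots> \<longleftrightarrow> pettiest l p' I"
      by (simp add: pettiest_def)
    finally show ?thesis .
  qed
  then show ?thesis by simp
qed

end
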